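(* Let $b,c,\nu,\rho\in\mathbb{C}$ with $\operatorname{Re}(\nu)>-1$ and $\operatorname{Re}(\rho)>0$. For $z\in\mathbb{C}\setminus(-\infty,0]$, $$\frac{\partial}{\partial z}\Big[z^{\nu+1}\frac{\partial}{\partial z}\big(z^{-\nu} G_\nu^{(b,c-1)}(z;\rho)\big)\Big]=-b(c-1)\,G_{\nu+1}^{(b,c)}(z;\rho).$$
   Context: For $\rho\in\mathbb{C}$ with $\operatorname{Re}(\rho)>0$ and $x\in\mathbb{C}$ put $\Gamma_\rho(x)=\int_0^\infty t^{x-1}e^{-t-\rho/t}\,dt$. The generalized Pochhammer symbol is $(\lambda;\rho)_\nu:=\Gamma_\rho(\lambda+\nu)/\Gamma(\lambda)$ for $\lambda,\nu\in\mathbb{C}$, where $1/\Gamma$ is read as an entire function (zero at $0,-1,-2,\dots$). The unified four parameter Bessel function is $$G_\nu^{(b,c)}(z;\rho):=\sum_{k=0}^\infty \frac{(-b)^k (c;\rho)_{2k+\nu}}{\Gamma(\nu+k+1)\,\Gamma(\nu+2k+1)}\,\frac{(z/2)^{2k+\nu}}{k!}.$$ Complex powers are principal. *)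

theory Defs
  imports "HOL-Analysis.Analysis"
begin

definition Gamma_ext :: "complex \<Rightarrow> complex \<Rightarrow> complex" where
  "Gamma_ext \<rho> x =
     (LINT t:{0<..}|lborel.
        complex_of_real t powr (x - 1) * exp (- complex_of_real t - \<rho> / complex_of_real t))"

(* rGamma is the entire function 1/Gamma, so the symbol is 0 for l = 0, -1, -2, ... *)
definition pochhammer_ext :: "complex \<Rightarrow> complex \<Rightarrow> complex \<Rightarrow> complex" where
  "pochhammer_ext l \<rho> \<nu> = Gamma_ext \<rho> (l + \<nu>) * rGamma l"

(* The function G_\<nu>^(b,c)(z; \<rho>). *)
definition unified_Bessel ::
    "complex \<Rightarrow> complex \<Rightarrow> complex \<Rightarrow> complex \<Rightarrow> complex \<Rightarrow> complex" where
  "unified_Bessel b c \<nu> \<rho> z =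
     (\<Sum>k. (- b) ^ k * pochhammer_ext c \<rho> (2 * of_nat k + \<nu>)
            / (Gamma (\<nu> + of_nat k + 1) * Gamma (\<nu> + 2 * of_nat k + 1))
            * ((z / 2) powr (2 * of_nat k + \<nu>) / fact k))"

end

theory Submission imports Defs begin

text \<open>
  Off the cut, \<open>G\<close> is a branched power times an entire function: with \<open>A\<^sub>k\<close> the coefficients
  of its defining series, \<open>G(z) = (z/2)\<^sup>\<nu> F((z/2)\<^sup>2)\<close> where \<open>F(w) = \<Sum> A\<^sub>k w\<^sup>k\<close>.
  Hence \<open>z\<^sup>-\<^sup>\<nu> G(z)\<close> is a constant multiple of \<open>F((z/2)\<^sup>2)\<close>, and the chain rule turns the
  left-hand side of the theorem into
  \<open>(z/2)\<close> to the power \<open>\<nu> + 1\<close> times \<open>(\<nu> + 2) F'(w) + 2 w F''(w)\<close> at \<open>w = (z/2)\<^sup>2\<close>.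
  The coefficient of \<open>w\<^sup>k\<close> in the second factor is \<open>(k + 1) (\<nu> + 2 + 2 k)\<close> times the
  coefficient of index \<open>k + 1\<close> of \<open>F\<close>. Those two numbers are the ones that the functional
  equations of the factorial and of \<open>Gamma\<close> at \<open>\<nu> + 2 + 2 k\<close> cancel, while \<open>c - 1\<close> comes out of \<open>rGamma (c - 1)\<close>
  (lemma \<open>unified_Bessel_coeff_rec\<close>).

  The extended Gamma factor is carried along unchanged: raising \<open>k\<close> by one in its argument
  \<open>c - 1 + 2 k + \<nu>\<close> has the same effect as raising \<open>c - 1\<close> and \<open>\<nu>\<close> by one each. Its size
  decides convergence. Two crude exponential inequalities under the integral sign show that
  its value at \<open>x + n\<close> is at most a constant times \<open>n! 2\<^sup>n\<close> (lemma \<open>norm_Gamma_ext_shift_le\<close>),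
  and against the Gamma factors of the denominator this is small enough for the ratio test to
  make \<open>F\<close> entire.
\<close>

section \<open>Growth of the extended Gamma function\<close>

lemma power_le_fact_mult_exp:
  fixes y :: real
  assumes "y \<ge> 0"
  shows "y ^ n \<le> fact n * exp y"
proof -
  have "y ^ n /\<^sub>R fact n \<le> (\<Sum>k. y ^ k /\<^sub>R fact k)"
    using sum_le_suminf[OF sums_summable[OF exp_converges[of y]], of "{n}"] assms by simp
  also have "\<dots> = exp y"
    using exp_converges[of y] by (simp add: sums_iff)
  finally show ?thesis by (simp add: field_simps)
qed

lemma set_integrable_powr_mult_exp_neg:
  fixes a s :: real
  assumes "s > 0" "a > 0"
  shows "set_integrable lborel {0<..} (\<lambda>t. t powr (s - 1) * exp (- a * t))"
proof -
  let ?f = "\<lambda>t. complex_of_real t powr (complex_of_real s - 1) / of_real (exp (a * t))"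
  have "set_integrable lebesgue {0<..} ?f"
    using absolutely_integrable_Gamma_integral[of "of_real s" a] assms by simp
  then have "set_integrable lebesgue {0<..} (\<lambda>t. norm (?f t))"
    by (rule set_integrable_norm)
  also have "?this \<longleftrightarrow> set_integrable lebesgue {0<..} (\<lambda>t. t powr (s - 1) * exp (- a * t))"
    by (intro set_integrable_cong refl)
       (auto simp: norm_divide norm_powr_real_powr exp_minus field_simps)
  also have "\<dots> \<longleftrightarrow> set_integrable lborel {0<..} (\<lambda>t. t powr (s - 1) * exp (- a * t))"
    unfolding set_integrable_def by (rule integrable_completion) measurable
  finally show ?thesis .
qed

text \<open>
  The decay \<open>exp (- t)\<close> is spent in two halves: one half against \<open>t ^ n\<close>, which costs
  \<open>n! 2 ^ n\<close>, the other on integrability at infinity. Integrability at \<open>0\<close>, where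
  \<open>t powr (Re x - 1)\<close> may be arbitrarily singular, comes from \<open>exp (- Re \<rho> / t)\<close>, which beats
  every power of \<open>t\<close>. What remains under the integral is a classical Gamma integrand
  that is independent of \<open>n\<close>.
\<close>

lemma norm_Gamma_ext_shift_le:
  assumes "Re \<rho> > 0"
  shows "\<exists>C. \<forall>n::nat. norm (Gamma_ext \<rho> (x + of_nat n)) \<le> C * (fact n * 2 ^ n)"
proof -
  define r where "r = Re \<rho>"
  have r: "r > 0" using assms by (simp add: r_def)
  obtain m :: nat where m: "Re x + real m > 0"
    using reals_Archimedean2[of "- Re x"] by (metis minus_less_iff diff_less_eq diff_0 add.commute)
  define g where "g = (\<lambda>t::real. t powr (Re x + real m - 1) * exp (- (1/2) * t))"
  define C where "C = fact m / r ^ m * (LINT t:{0<..}|lborel. g t)"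
  have g_int: "set_integrable lborel {0<..} g"
    unfolding g_def by (rule set_integrable_powr_mult_exp_neg) (use m in auto)
  have "norm (Gamma_ext \<rho> (x + of_nat n)) \<le> C * (fact n * 2 ^ n)" for n :: nat
  proof -
    let ?f = "\<lambda>t. complex_of_real t powr (x + of_nat n - 1) * exp (- complex_of_real t - \<rho> / complex_of_real t)"
    let ?K = "(fact n * 2 ^ n) * (fact m / r ^ m) :: real"
    have bound: "norm (?f t) \<le> ?K * g t" if t: "t > 0" for t
    proof -
      have 1: "t ^ n * exp (- (1/2) * t) \<le> fact n * 2 ^ n"
        using power_le_fact_mult_exp[of "t / 2" n] t
        by (simp add: power_divide exp_minus field_simps)
      have 2: "exp (- (r / t)) \<le> fact m / r ^ m * t ^ m"
        using power_le_fact_mult_exp[of "r / t" m] t r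
        by (simp add: power_divide exp_minus field_simps)
      have "norm (?f t) = t powr (Re x + real n - 1) * exp (- t - r / t)"
        using t by (simp add: norm_mult norm_powr_real_powr r_def Re_divide_of_real)
      also have "\<dots> = t powr (Re x - 1) * exp (- (1/2) * t) *
                        (t ^ n * exp (- (1/2) * t)) * exp (- (r / t))"
        using t by (simp add: powr_add powr_diff powr_realpow exp_diff exp_minus
            flip: exp_add) (simp add: field_simps flip: exp_add)
      also have "\<dots> \<le> t powr (Re x - 1) * exp (- (1/2) * t) *
                        (fact n * 2 ^ n) * (fact m / r ^ m * t ^ m)"
        using t r by (intro mult_mono 1 2 mult_nonneg_nonneg) auto
      also have "\<dots> = ?K * g t"
        using t by (simp add: g_def powr_add powr_diff powr_realpow field_simps)
      finally show ?thesis .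
    qed
    \<comment> \<open>Were the integrand of \<open>Gamma_ext\<close> not integrable, its integral would be \<open>0\<close> by default;
      the comparison therefore rests on integrability of the larger function alone.\<close>
    have "norm (Gamma_ext \<rho> (x + of_nat n))
            \<le> (\<integral>t. norm (indicator {0<..} t *\<^sub>R ?f t) \<partial>lborel)"
      unfolding Gamma_ext_def set_lebesgue_integral_def by (rule integral_norm_bound)
    also have "\<dots> \<le> (\<integral>t. ?K * (indicator {0<..} t *\<^sub>R g t) \<partial>lborel)"
    proof (rule integral_mono')
      show "integrable lborel (\<lambda>t. ?K * (indicator {0<..} t *\<^sub>R g t))"
        using g_int unfolding set_integrable_def by (rule integrable_mult_right)
      show "norm (indicator {0<..} t *\<^sub>R ?f t) \<le> ?K * (indicator {0<..} t *\<^sub>R g t)" for t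
        using bound[of t] by (cases "t > 0") auto
      show "0 \<le> ?K * (indicator {0<..} t *\<^sub>R g t)" for t
        using r by (auto simp: g_def indicator_def)
    qed
    also have "\<dots> = C * (fact n * 2 ^ n)"
      by (simp add: C_def set_lebesgue_integral_def)
    finally show ?thesis .
  qed
  then show ?thesis by blast
qed

section \<open>The entire factor of the Bessel function\<close>

definition unified_Bessel_coeff ::
    "complex \<Rightarrow> complex \<Rightarrow> complex \<Rightarrow> complex \<Rightarrow> nat \<Rightarrow> complex" where
  "unified_Bessel_coeff b c \<nu> \<rho> k =
     (- b) ^ k * pochhammer_ext c \<rho> (2 * of_nat k + \<nu>)
       / (Gamma (\<nu> + of_nat k + 1) * Gamma (\<nu> + 2 * of_nat k + 1) * fact k)"

text \<open>
  The variable stands for \<open>(z/2)\<^sup>2\<close>, the analogue of passing from the Bessel function to the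
  Bessel--Clifford function: the series then has no gaps and the termwise differentiation of
  power series applies to it directly.
\<close>

definition unified_Bessel_entire ::
    "complex \<Rightarrow> complex \<Rightarrow> complex \<Rightarrow> complex \<Rightarrow> complex \<Rightarrow> complex" where
  "unified_Bessel_entire b c \<nu> \<rho> w = (\<Sum>k. unified_Bessel_coeff b c \<nu> \<rho> k * w ^ k)"

lemma Gamma_neq_0_of_Re_pos: "Gamma z \<noteq> 0" if "Re z > 0" for z :: complex
proof -
  have "z \<notin> \<int>\<^sub>\<le>\<^sub>0" using that by (auto elim!: nonpos_Ints_cases)
  then show ?thesis by (simp add: Gamma_eq_zero_iff)
qed

lemma Gamma_plus1_of_Re_pos: "Gamma (z + 1) = z * Gamma z" if "Re z > 0" for z :: complex
  by (rule Gamma_plus1) (use that in \<open>auto elim!: nonpos_Ints_cases\<close>)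

text \<open>
  Consecutive terms have a quotient of order \<open>R / k\<^sup>2\<close>: the factor \<open>(2 k + 1) (2 k + 2)\<close> from the
  numerator is matched by \<open>Gamma (\<nu> + 2 k + 1)\<close>, and both other factors of the denominator
  gain an order of \<open>k\<close>.
\<close>

lemma summable_fact_div_Gamma:
  fixes \<nu> :: complex and R :: real
  assumes "Re \<nu> > -1" "R \<ge> 0"
  shows "summable (\<lambda>k. R ^ k * fact (2 * k) /
           (norm (Gamma (\<nu> + of_nat k + 1)) * norm (Gamma (\<nu> + 2 * of_nat k + 1)) * fact k))"
    (is "summable ?M")
proof (rule summable_ratio_test)
  show "(1/2 :: real) < 1" by simp
next
  fix k :: nat
  \<comment> \<open>From here on \<open>2 R \<le> k \<le> k\<^sup>2\<close>, which makes the quotient \<open>R / k\<^sup>2\<close> at most a half.\<close>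
  assume k: "k \<ge> nat \<lceil>2 * R\<rceil> + 1"
  then have k1: "real k \<ge> 1" and kR: "2 * R \<le> real k" by linarith+
  let ?x = "norm (\<nu> + of_nat k + 1)" and ?y = "norm (\<nu> + 2 * of_nat k + 1)"
    and ?z = "norm (\<nu> + 2 * of_nat k + 2)"
  have G1: "Gamma (\<nu> + of_nat (Suc k) + 1) = (\<nu> + of_nat k + 1) * Gamma (\<nu> + of_nat k + 1)"
    using Gamma_plus1_of_Re_pos[of "\<nu> + of_nat k + 1"] assms by (simp add: algebra_simps)
  have G2: "Gamma (\<nu> + 2 * of_nat (Suc k) + 1) =
      (\<nu> + 2 * of_nat k + 2) * ((\<nu> + 2 * of_nat k + 1) * Gamma (\<nu> + 2 * of_nat k + 1))"
    using Gamma_plus1_of_Re_pos[of "\<nu> + 2 * of_nat k + 1"]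
      Gamma_plus1_of_Re_pos[of "\<nu> + 2 * of_nat k + 2"] assms
    by (simp add: algebra_simps)
  have F: "(fact (2 * Suc k) :: real) = (2 * real k + 2) * ((2 * k + 1) * fact (2 * k))"
    by (simp add: algebra_simps)
  \<comment> \<open>The real parts bound the moduli from below, and \<open>Re \<nu> > -1\<close> bounds the real parts.\<close>
  have x: "real k \<le> ?x" and y: "2 * real k \<le> ?y" and z: "2 * real k + 1 \<le> ?z"
    using complex_Re_le_cmod[of "\<nu> + of_nat k + 1"] complex_Re_le_cmod[of "\<nu> + 2 * of_nat k + 1"]
      complex_Re_le_cmod[of "\<nu> + 2 * of_nat k + 2"] assms by simp_all
  have num_nonneg: "0 \<le> R * (2 * real k + 2) * (2 * real k + 1)"
    using assms(2) by simp
  have denom_pos: "0 < real k * (2 * real k * (2 * real k + 1)) * (real k + 1)"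
    using k1 by (intro mult_pos_pos) auto
  have denom_le: "real k * (2 * real k * (2 * real k + 1)) * (real k + 1) \<le> ?x * (?y * ?z) * (real k + 1)"
    using x y z by (intro mult_mono mult_nonneg_nonneg) auto
  have sq: "2 * R \<le> (real k)\<^sup>2"
    using kR self_le_power[of "real k" 2] k1 by linarith
  define q where "q = R * (2 * real k + 2) * (2 * real k + 1) / (?x * (?y * ?z) * (real k + 1))"
  have step: "?M (Suc k) = q * ?M k"
    unfolding q_def G1 G2 F norm_mult fact_Suc power_Suc times_divide_times_eq
    by (simp add: mult_ac add_ac) (simp add: algebra_simps)
  have "q \<le> R * (2 * real k + 2) * (2 * real k + 1) /
      (real k * (2 * real k * (2 * real k + 1)) * (real k + 1))"
    unfolding q_def by (rule divide_left_mono[OF denom_le num_nonneg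
          mult_pos_pos[OF less_le_trans[OF denom_pos denom_le] denom_pos]])
  also have "\<dots> = R / (real k)\<^sup>2"
    using k1 by (simp add: divide_simps power2_eq_square)
  also have "\<dots> \<le> 1/2"
    using sq k1 by (simp add: field_simps)
  finally have "q * ?M k \<le> 1/2 * ?M k"
    by (rule mult_right_mono) (use assms(2) in simp)
  then have "?M (Suc k) \<le> 1/2 * ?M k"
    unfolding step .
  moreover have "norm (?M n) = ?M n" for n
    unfolding real_norm_def by (rule abs_of_nonneg) (use assms(2) in simp)
  ultimately show "norm (?M (Suc k)) \<le> 1/2 * norm (?M k)"
    by (simp only:)
qed

lemma summable_unified_Bessel_coeff:
  assumes "Re \<nu> > -1" "Re \<rho> > 0"
  shows "summable (\<lambda>k. unified_Bessel_coeff b c \<nu> \<rho> k * w ^ k)"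
proof -
  obtain C where C: "norm (Gamma_ext \<rho> (c + \<nu> + of_nat n)) \<le> C * (fact n * 2 ^ n)" for n
    using norm_Gamma_ext_shift_le[OF assms(2), of "c + \<nu>"] by blast
  \<comment> \<open>The factor 4 absorbs the \<open>2 ^ (2 * k)\<close> of the integral bound at shift \<open>2 * k\<close>.\<close>
  let ?R = "4 * norm b * norm w"
  have four: "(2 :: real) ^ (2 * k) = 4 ^ k" for k :: nat
    by (simp add: power_mult)
  let ?D = "\<lambda>k. norm (Gamma (\<nu> + of_nat k + 1)) * norm (Gamma (\<nu> + 2 * of_nat k + 1)) * fact k"
  show ?thesis
  proof (rule summable_comparison_test', rule summable_mult[OF summable_fact_div_Gamma])
    show "Re \<nu> > -1" "?R \<ge> 0" using assms by auto
    fix k :: nat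
    have "norm (pochhammer_ext c \<rho> (2 * of_nat k + \<nu>)) =
        norm (Gamma_ext \<rho> (c + \<nu> + of_nat (2 * k))) * norm (rGamma c)"
      by (simp add: pochhammer_ext_def norm_mult add_ac)
    also have "\<dots> \<le> C * (fact (2 * k) * 4 ^ k) * norm (rGamma c)"
      unfolding four[symmetric] by (intro mult_right_mono C) auto
    finally have "norm (pochhammer_ext c \<rho> (2 * of_nat k + \<nu>)) * ((norm b * norm w) ^ k / ?D k)
        \<le> C * (fact (2 * k) * 4 ^ k) * norm (rGamma c) * ((norm b * norm w) ^ k / ?D k)"
      by (rule mult_right_mono) auto
    then show "norm (unified_Bessel_coeff b c \<nu> \<rho> k * w ^ k)
        \<le> C * norm (rGamma c) * (?R ^ k * fact (2 * k) / ?D k)"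
      by (simp add: unified_Bessel_coeff_def norm_mult norm_divide norm_power
          power_mult_distrib mult_ac)
  qed
qed

lemma unified_Bessel_eq_entire:
  assumes "z \<noteq> 0"
    and "Re \<nu> > -1" "Re \<rho> > 0"
  shows "unified_Bessel b c \<nu> \<rho> z = (z / 2) powr \<nu> * unified_Bessel_entire b c \<nu> \<rho> ((z / 2)\<^sup>2)"
proof -
  have "(z / 2) powr (2 * of_nat k + \<nu>) = (z / 2) powr \<nu> * ((z / 2)\<^sup>2) ^ k" for k :: nat
  proof -
    have "(z / 2) powr (2 * of_nat k + \<nu>) = (z / 2) powr (of_nat (2 * k)) * (z / 2) powr \<nu>"
      by (simp add: powr_add)
    also have "(z / 2) powr (of_nat (2 * k)) = ((z / 2)\<^sup>2) ^ k"
      using assms by (subst powr_complexpow) (auto simp: power_mult)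
    finally show ?thesis by (simp add: mult.commute)
  qed
  then have "unified_Bessel b c \<nu> \<rho> z =
      (\<Sum>k. (z / 2) powr \<nu> * (unified_Bessel_coeff b c \<nu> \<rho> k * ((z / 2)\<^sup>2) ^ k))"
    unfolding unified_Bessel_def unified_Bessel_coeff_def by (simp add: mult_ac)
  also have "\<dots> = (z / 2) powr \<nu> * unified_Bessel_entire b c \<nu> \<rho> ((z / 2)\<^sup>2)"
    unfolding unified_Bessel_entire_def
    by (intro suminf_mult summable_unified_Bessel_coeff assms)
  finally show ?thesis .
qed

section \<open>The differential relation\<close>

text \<open>
  Both sides contain the same value of \<open>Gamma_ext\<close>, because
  \<open>(c - 1) + (2 (k + 1) + \<nu>) = c + (2 k + (\<nu> + 1))\<close>. The rest is
  \<open>rGamma (c - 1) = (c - 1) rGamma c\<close> and the functional equation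
  of one of the two Gamma factors in the denominator.
\<close>

lemma unified_Bessel_coeff_rec:
  assumes "Re \<nu> > -1"
  shows "of_nat (Suc k) * (\<nu> + 2 + 2 * of_nat k) * unified_Bessel_coeff b (c - 1) \<nu> \<rho> (Suc k) =
    - b * (c - 1) * unified_Bessel_coeff b c (\<nu> + 1) \<rho> k"
proof -
  have cancel: "K * Y * (- b * B * ((c - 1) * P) / (G1 * (Y * G2) * (K * f)))
      = - b * (c - 1) * (B * P / (G1 * G2 * f))"
    if "K \<noteq> 0" "Y \<noteq> 0" for K Y B P G1 G2 f :: complex
    using that by (simp add: divide_simps)
  have G2: "Gamma (\<nu> + 2 * of_nat (Suc k) + 1)
      = (\<nu> + 2 + 2 * of_nat k) * Gamma (\<nu> + 1 + 2 * of_nat k + 1)"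
    using Gamma_plus1_of_Re_pos[of "\<nu> + 2 + 2 * of_nat k"] assms by (simp add: algebra_simps)
  have G1: "Gamma (\<nu> + of_nat (Suc k) + 1) = Gamma (\<nu> + 1 + of_nat k + 1)"
    by (simp add: algebra_simps)
  have shift: "c - 1 + (2 * of_nat (Suc k) + \<nu>) = c + (2 * of_nat k + (\<nu> + 1))" by simp
  have rG: "rGamma (c - 1) = (c - 1) * rGamma c"
    using rGamma_plus1[of "c - 1"] by simp
  have P: "pochhammer_ext (c - 1) \<rho> (2 * of_nat (Suc k) + \<nu>) =
      (c - 1) * pochhammer_ext c \<rho> (2 * of_nat k + (\<nu> + 1))"
    unfolding pochhammer_ext_def shift rG by (rule mult.left_commute)
  show ?thesis
    unfolding unified_Bessel_coeff_def power_Suc G1 G2 P fact_Suc of_nat_mult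
  proof (rule cancel)
    show "of_nat (Suc k) \<noteq> (0 :: complex)" by (rule of_nat_neq_0)
    show "\<nu> + 2 + 2 * of_nat k \<noteq> 0" using assms by (auto simp: complex_eq_iff)
  qed
qed

text \<open>
  The coefficient of \<open>w ^ k\<close> in \<open>(\<nu> + 2) F' w + 2 w F'' w\<close> is the left-hand side of the recurrence
  above. The combination is the one produced by differentiating
  \<open>u powr (\<nu> + 2) * F' ((u / 2)\<^sup>2)\<close>.
\<close>

lemma unified_Bessel_entire_deriv_eq:
  fixes b c \<nu> \<rho> :: complex
  assumes "Re \<nu> > -1" "Re \<rho> > 0"
  defines "F \<equiv> unified_Bessel_entire b (c - 1) \<nu> \<rho>"
  obtains F' F'' where "\<And>w. (F has_field_derivative F' w) (at w)"
    and "\<And>w. (F' has_field_derivative F'' w) (at w)"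
    and "\<And>w. (\<nu> + 2) * F' w + 2 * w * F'' w = - b * (c - 1) * unified_Bessel_entire b c (\<nu> + 1) \<rho> w"
proof
  define a where "a = unified_Bessel_coeff b (c - 1) \<nu> \<rho>"
  have sa: "summable (\<lambda>n. a n * w ^ n)" for w
    unfolding a_def by (rule summable_unified_Bessel_coeff[OF assms(1,2)])
  have s1: "summable (\<lambda>n. diffs a n * w ^ n)" for w
    by (rule termdiff_converges_all) (rule sa)
  have s2: "summable (\<lambda>n. diffs (diffs a) n * w ^ n)" for w
    by (rule termdiff_converges_all) (rule s1)
  let ?F' = "\<lambda>w. \<Sum>n. diffs a n * w ^ n" and ?F'' = "\<lambda>w. \<Sum>n. diffs (diffs a) n * w ^ n"
  fix w
  show "(F has_field_derivative ?F' w) (at w)"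
    unfolding F_def unified_Bessel_entire_def a_def[symmetric]
    by (rule termdiffs_strong_converges_everywhere) (rule sa)
  show "(?F' has_field_derivative ?F'' w) (at w)"
    by (rule termdiffs_strong_converges_everywhere) (rule s1)
  have "(\<lambda>n. w * (of_nat n * diffs a n * w ^ (n - Suc 0))) sums (w * ?F'' w)"
    by (intro sums_mult diffs_equiv s2)
  also have "(\<lambda>n. w * (of_nat n * diffs a n * w ^ (n - Suc 0))) = (\<lambda>n. of_nat n * diffs a n * w ^ n)"
  proof
    show "w * (of_nat n * diffs a n * w ^ (n - Suc 0)) = of_nat n * diffs a n * w ^ n" for n
      by (cases n) auto
  qed
  finally have "(\<lambda>n. (\<nu> + 2) * (diffs a n * w ^ n) + 2 * (of_nat n * diffs a n * w ^ n))
      sums ((\<nu> + 2) * ?F' w + 2 * (w * ?F'' w))"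
    by (intro sums_add sums_mult summable_sums s1)
  also have "(\<lambda>n. (\<nu> + 2) * (diffs a n * w ^ n) + 2 * (of_nat n * diffs a n * w ^ n)) =
      (\<lambda>n. - b * (c - 1) * (unified_Bessel_coeff b c (\<nu> + 1) \<rho> n * w ^ n))"
  proof
    fix n
    have "(\<nu> + 2) * (diffs a n * w ^ n) + 2 * (of_nat n * diffs a n * w ^ n) =
        of_nat (Suc n) * (\<nu> + 2 + 2 * of_nat n) * a (Suc n) * w ^ n"
      by (simp add: diffs_def algebra_simps)
    also have "\<dots> = - b * (c - 1) * (unified_Bessel_coeff b c (\<nu> + 1) \<rho> n * w ^ n)"
      unfolding a_def unified_Bessel_coeff_rec[OF assms(1)] by (simp add: mult_ac)
    finally show "(\<nu> + 2) * (diffs a n * w ^ n) + 2 * (of_nat n * diffs a n * w ^ n) =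
        - b * (c - 1) * (unified_Bessel_coeff b c (\<nu> + 1) \<rho> n * w ^ n)" .
  qed
  finally have "(\<lambda>n. - b * (c - 1) * (unified_Bessel_coeff b c (\<nu> + 1) \<rho> n * w ^ n))
      sums ((\<nu> + 2) * ?F' w + 2 * (w * ?F'' w))" .
  moreover have "(\<lambda>n. - b * (c - 1) * (unified_Bessel_coeff b c (\<nu> + 1) \<rho> n * w ^ n))
      sums (- b * (c - 1) * unified_Bessel_entire b c (\<nu> + 1) \<rho> w)"
    unfolding unified_Bessel_entire_def
    by (intro sums_mult summable_sums summable_unified_Bessel_coeff) (use assms in auto)
  ultimately show "(\<nu> + 2) * ?F' w + 2 * w * ?F'' w =
      - b * (c - 1) * unified_Bessel_entire b c (\<nu> + 1) \<rho> w"
    by (simp add: sums_iff mult.assoc)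
qed

lemma half_powr: "(z / 2) powr s = z powr s / 2 powr s" for z s :: complex
proof -
  have "(2 * (z / 2)) powr s = 2 powr s * (z / 2) powr s"
    by (rule powr_times_real_left) auto
  then show ?thesis by simp
qed

theorem theorem3p2:
  fixes b c \<nu> \<rho> z :: complex
  assumes "Re \<nu> > -1" and "Re \<rho> > 0" and "z \<notin> \<real>\<^sub>\<le>\<^sub>0"
  shows "(\<lambda>u. u powr (- \<nu>) * unified_Bessel b (c - 1) \<nu> \<rho> u) field_differentiable (at z)
    \<and> ((\<lambda>w. w powr (\<nu> + 1) * deriv (\<lambda>u. u powr (- \<nu>) * unified_Bessel b (c - 1) \<nu> \<rho> u) w)
         has_field_derivative (- b * (c - 1) * unified_Bessel b c (\<nu> + 1) \<rho> z)) (at z)"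
proof -
  let ?f = "\<lambda>u. u powr (- \<nu>) * unified_Bessel b (c - 1) \<nu> \<rho> u"
  define F where "F = unified_Bessel_entire b (c - 1) \<nu> \<rho>"
  obtain F' F'' where F': "\<And>w. (F has_field_derivative F' w) (at w)"
    and F'': "\<And>w. (F' has_field_derivative F'' w) (at w)"
    and ode: "\<And>w. (\<nu> + 2) * F' w + 2 * w * F'' w =
      - b * (c - 1) * unified_Bessel_entire b c (\<nu> + 1) \<rho> w"
    using unified_Bessel_entire_deriv_eq[OF assms(1,2), of b c] unfolding F_def by metis
  have S: "open (- \<real>\<^sub>\<le>\<^sub>0 :: complex set)" by (simp add: open_Compl)
  have f_eq: "F ((u / 2)\<^sup>2) / 2 powr \<nu> = ?f u" if "u \<in> - \<real>\<^sub>\<le>\<^sub>0" for u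
  proof -
    have "u \<noteq> 0" using that by auto
    then show ?thesis
      using assms by (simp add: unified_Bessel_eq_entire F_def half_powr powr_minus)
  qed
  have f': "(?f has_field_derivative F' ((u / 2)\<^sup>2) * (u / 2) / 2 powr \<nu>) (at u)"
    if "u \<in> - \<real>\<^sub>\<le>\<^sub>0" for u
  proof (rule has_field_derivative_transform_within_open[OF _ S that f_eq])
    show "((\<lambda>u. F ((u / 2)\<^sup>2) / 2 powr \<nu>) has_field_derivative
            F' ((u / 2)\<^sup>2) * (u / 2) / 2 powr \<nu>) (at u)"
      by (rule derivative_eq_intros DERIV_chain2[OF F'] refl | simp)+
  qed
  \<comment> \<open>Off the cut this is \<open>u powr (\<nu> + 1) * deriv ?f u\<close>, with the inner derivative \<open>u / 2\<close>
    absorbed into the power.\<close>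
  let ?h = "\<lambda>u. u powr (\<nu> + 2) * F' ((u / 2)\<^sup>2) / 2 powr (\<nu> + 1)"
  have z0: "z \<noteq> 0" using assms(3) by auto
  have "(?h has_field_derivative
      ((\<nu> + 2) * z powr (\<nu> + 2 - 1) * F' ((z / 2)\<^sup>2)
        + F'' ((z / 2)\<^sup>2) * (z / 2) * z powr (\<nu> + 2)) / 2 powr (\<nu> + 1)) (at z)"
    by (rule derivative_eq_intros has_field_derivative_powr[OF assms(3)] DERIV_chain2[OF F'']
        refl | simp)+
  also have "((\<nu> + 2) * z powr (\<nu> + 2 - 1) * F' ((z / 2)\<^sup>2)
        + F'' ((z / 2)\<^sup>2) * (z / 2) * z powr (\<nu> + 2)) / 2 powr (\<nu> + 1)
      = (z / 2) powr (\<nu> + 1) * ((\<nu> + 2) * F' ((z / 2)\<^sup>2) + 2 * (z / 2)\<^sup>2 * F'' ((z / 2)\<^sup>2))"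
  proof -
    have "z powr (\<nu> + 2) = z * z powr (\<nu> + 1)"
      using z0 powr_add[of z "\<nu> + 1" 1] by (simp add: add.assoc mult.commute)
    moreover have "z powr (\<nu> + 2 - 1) = z powr (\<nu> + 1)" by (simp add: algebra_simps)
    ultimately show ?thesis
      by (simp add: half_powr field_simps power2_eq_square)
  qed
  also have "\<dots> = - b * (c - 1) * unified_Bessel b c (\<nu> + 1) \<rho> z"
    unfolding ode using z0 assms by (simp add: unified_Bessel_eq_entire mult_ac)
  finally have h': "(?h has_field_derivative - b * (c - 1) * unified_Bessel b c (\<nu> + 1) \<rho> z) (at z)" .
  have h_eq: "?h u = u powr (\<nu> + 1) * deriv ?f u" if u: "u \<in> - \<real>\<^sub>\<le>\<^sub>0" for u
  proof -
    have "u \<noteq> 0" using u by auto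
    then have pu: "u powr (\<nu> + 2) = u * u powr (\<nu> + 1)"
      using powr_add[of u "\<nu> + 1" 1] by (simp add: add.assoc mult.commute)
    have p2: "(2 :: complex) powr (\<nu> + 1) = 2 powr \<nu> * 2"
      by (simp add: powr_add)
    show ?thesis
      unfolding DERIV_imp_deriv[OF f'[OF u]] pu p2 by (simp add: mult_ac)
  qed
  have "((\<lambda>w. w powr (\<nu> + 1) * deriv ?f w) has_field_derivative
      - b * (c - 1) * unified_Bessel b c (\<nu> + 1) \<rho> z) (at z)"
    by (rule has_field_derivative_transform_within_open[OF h' S _ h_eq]) (use assms(3) in auto)
  moreover have "?f field_differentiable (at z)"
    using f'[of z] assms(3) unfolding field_differentiable_def by auto
  ultimately show ?thesis by blast
qed

end
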